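(* Let $X$ be an arbitrary Hausdorff $\mu$-space. If $AP_2(X)$ or $FP_2(X)$ is locally compact, then $X$ is homeomorphic to the topological sum of a compact space and a discrete space.
   Context: A paratopological group is a group with a topology such that multiplication is continuous. The (Markov) free paratopological group $FP(X)$ on a ($T_0$) space $X$ is the paratopological group $G$ that contains $X$ as a subspace, is algebraically generated by $X$, and is such that every continuous map $f:X\to H$ to a paratopological group $H$ extends to a continuous homomorphism $\hat f:G\to H$; its underlying group is the abstract free group on $X$. The free Abelian paratopological group $AP(X)$ is defined in the same way with all groups Abelian; its underlying group is the free Abelian group on $X$. $FP_2(X)$ and $AP_2(X)$ denote the subspaces of $FP(X)$ and $AP(X)$, respectively, consisting of all words of reduced length $\le 2$ with respect to the free basis $X$. A subset $A$ of a space $Z$ is bounded in $Z$ if every real-valued continuous function on $Z$ is bounded on $A$. A space $Z$ is a $\mu$-space if the closure of every bounded subset of $Z$ is compact. A space is locally compact if every point has a compact neighborhood. *)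

theory Defs
  imports "HOL-Analysis.Analysis" "HOL-Algebra.Free_Abelian_Groups"
begin

section \<open>The abstract free group on a set\<close>

text \<open>
  A letter \<open>(x, True)\<close> stands for the generator \<open>x\<close>, a letter \<open>(x, False)\<close> for its inverse.
  Elements of the free group are the reduced words; the product is concatenation followed by
  reduction.
\<close>

type_synonym 'a word = "('a \<times> bool) list"

definition reduced :: "'a word \<Rightarrow> bool" where
  "reduced = successively (\<lambda>a b. \<not> (fst a = fst b \<and> snd a \<noteq> snd b))"

fun cons_cancel :: "'a \<times> bool \<Rightarrow> 'a word \<Rightarrow> 'a word" where
  "cons_cancel a [] = [a]"
| "cons_cancel a (b # w) = (if fst a = fst b \<and> snd a \<noteq> snd b then w else a # b # w)"

definition free_group :: "'a set \<Rightarrow> 'a word monoid" where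
  "free_group S = \<lparr>carrier = {w. reduced w \<and> fst ` set w \<subseteq> S},
                   monoid.mult = (\<lambda>u v. foldr cons_cancel u v), one = []\<rparr>"

abbreviation letter :: "'a \<Rightarrow> 'a word" where
  "letter x \<equiv> [(x, True)]"

definition letter_inv :: "'a \<times> bool \<Rightarrow> 'a \<times> bool" where
  "letter_inv a = (fst a, \<not> snd a)"

lemma reduced_Nil [simp]: "reduced []"
  by (simp add: reduced_def)

lemma reduced_single [simp]: "reduced [a]"
  by (simp add: reduced_def)

lemma reduced_Cons_Cons:
  "reduced (a # b # w) \<longleftrightarrow> \<not> (fst a = fst b \<and> snd a \<noteq> snd b) \<and> reduced (b # w)"
  by (simp add: reduced_def)

lemma reduced_tl: "reduced (a # w) \<Longrightarrow> reduced w"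
  by (cases w) (auto simp: reduced_Cons_Cons)

lemma reduced_cons_cancel: "reduced w \<Longrightarrow> reduced (cons_cancel a w)"
  by (cases w) (auto simp: reduced_Cons_Cons dest: reduced_tl)

lemma reduced_foldr: "reduced w \<Longrightarrow> reduced (foldr cons_cancel u w)"
  by (induction u) (auto intro: reduced_cons_cancel)

lemma cons_cancel_reduced: "reduced (a # w) \<Longrightarrow> cons_cancel a w = a # w"
  by (cases w) (auto simp: reduced_Cons_Cons)

lemma foldr_cons_cancel_Nil: "reduced w \<Longrightarrow> foldr cons_cancel w [] = w"
  by (induction w) (simp_all add: cons_cancel_reduced reduced_tl)

lemma letters_cons_cancel: "set (cons_cancel a w) \<subseteq> insert a (set w)"
  by (cases w) auto

lemma letters_foldr: "set (foldr cons_cancel u w) \<subseteq> set u \<union> set w"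
  by (induction u) (use letters_cons_cancel in fastforce)+

lemma cons_cancel_inverse:
  assumes "reduced w" "fst a = fst b" "snd a \<noteq> snd b"
  shows "cons_cancel a (cons_cancel b w) = w"
proof (cases w)
  case (Cons c v)
  then show ?thesis
    using assms by (cases v) (auto simp: reduced_Cons_Cons prod_eq_iff)
qed (use assms in auto)

lemma foldr_cons_cancel_step:
  assumes "reduced w"
  shows "foldr cons_cancel (cons_cancel a u) w = cons_cancel a (foldr cons_cancel u w)"
proof (cases u)
  case (Cons b v)
  then show ?thesis
    using cons_cancel_inverse[of "foldr cons_cancel v w" a b] reduced_foldr[OF assms, of v] by simp
qed simp

lemma foldr_cons_cancel_assoc:
  "reduced w \<Longrightarrow>
     foldr cons_cancel (foldr cons_cancel u v) w = foldr cons_cancel u (foldr cons_cancel v w)"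
  by (induction u) (auto simp: foldr_cons_cancel_step)

lemma foldr_cons_cancel_left_inverse:
  "reduced w \<Longrightarrow> foldr cons_cancel (rev (map letter_inv w)) w = []"
proof (induction w)
  case (Cons a w)
  have "cons_cancel (letter_inv a) (a # w) = w"
    by (simp add: letter_inv_def)
  then show ?case
    using Cons by (auto dest: reduced_tl)
qed simp

lemma reduced_rev_map_inv: "reduced w \<Longrightarrow> reduced (rev (map letter_inv w))"
  unfolding reduced_def successively_rev successively_map
  by (erule successively_mono) (auto simp: letter_inv_def)

lemma group_free_group: "group (free_group S)"
proof (rule groupI)
  fix x y assume "x \<in> carrier (free_group S)" "y \<in> carrier (free_group S)"
  then show "x \<otimes>\<^bsub>free_group S\<^esub> y \<in> carrier (free_group S)"
    using letters_foldr[of x y] by (fastforce simp: free_group_def reduced_foldr)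
next
  fix x assume x: "x \<in> carrier (free_group S)"
  let ?y = "rev (map letter_inv x)"
  have "?y \<in> carrier (free_group S)"
    using x by (auto simp: free_group_def reduced_rev_map_inv) (auto simp: letter_inv_def)
  moreover have "?y \<otimes>\<^bsub>free_group S\<^esub> x = \<one>\<^bsub>free_group S\<^esub>"
    using x by (simp add: free_group_def foldr_cons_cancel_left_inverse)
  ultimately show "\<exists>y\<in>carrier (free_group S). y \<otimes>\<^bsub>free_group S\<^esub> x = \<one>\<^bsub>free_group S\<^esub>"
    by blast
qed (auto simp: free_group_def foldr_cons_cancel_assoc)

lemma inv_letter:
  assumes "x \<in> S"
  shows "inv\<^bsub>free_group S\<^esub> (letter x) = [(x, False)]"
proof -
  interpret group "free_group S" by (rule group_free_group)
  show ?thesis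
    by (rule inv_equality) (use assms in \<open>auto simp: free_group_def\<close>)
qed

lemma free_group_generated: "generate (free_group S) (letter ` S) = carrier (free_group S)"
proof
  interpret group "free_group S" by (rule group_free_group)
  show "generate (free_group S) (letter ` S) \<subseteq> carrier (free_group S)"
    by (rule generate_incl) (auto simp: free_group_def)
  show "carrier (free_group S) \<subseteq> generate (free_group S) (letter ` S)"
  proof
    fix w assume "w \<in> carrier (free_group S)"
    then have "reduced w" "fst ` set w \<subseteq> S"
      by (auto simp: free_group_def)
    then show "w \<in> generate (free_group S) (letter ` S)"
    proof (induction w)
      case Nil
      then show ?case
        using generate.one[of "free_group S"] by (simp add: free_group_def)
    next
      case (Cons a w)
      obtain x b where a: "a = (x, b)" by (cases a)
      have x: "x \<in> S" using Cons.prems a by auto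
      have "[a] \<in> generate (free_group S) (letter ` S)"
        using generate.incl[of "letter x" "letter ` S" "free_group S"]
          generate.inv[of "letter x" "letter ` S" "free_group S"] x a
        by (cases b) (auto simp: inv_letter)
      moreover have "w \<in> generate (free_group S) (letter ` S)"
        using Cons by (auto dest: reduced_tl)
      ultimately have "[a] \<otimes>\<^bsub>free_group S\<^esub> w \<in> generate (free_group S) (letter ` S)"
        by (rule generate.eng)
      then show ?case
        using Cons.prems by (simp add: free_group_def cons_cancel_reduced)
    qed
  qed
qed

lemma free_group_universal:
  assumes "group H" and f: "f ` S \<subseteq> carrier H"
  obtains h where "h \<in> hom (free_group S) H" "\<And>x. x \<in> S \<Longrightarrow> h (letter x) = f x"
proof
  interpret group H by fact
  define val where "val a = (if snd a then f (fst a) else inv\<^bsub>H\<^esub> f (fst a))" for a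
  define h where "h w = foldr (\<lambda>a y. val a \<otimes>\<^bsub>H\<^esub> y) w \<one>\<^bsub>H\<^esub>" for w
  have val: "val a \<in> carrier H" if "fst a \<in> S" for a
    using that f by (auto simp: val_def)
  have h_closed: "h w \<in> carrier H" if "fst ` set w \<subseteq> S" for w
    using that by (induction w) (auto simp: h_def val)
  have h_cc: "h (cons_cancel a w) = val a \<otimes>\<^bsub>H\<^esub> h w"
    if "fst a \<in> S" "fst ` set w \<subseteq> S" for a w
  proof (cases w)
    case (Cons b v)
    show ?thesis
    proof (cases "fst a = fst b \<and> snd a \<noteq> snd b")
      case True
      then have "val a \<otimes>\<^bsub>H\<^esub> val b = \<one>\<^bsub>H\<^esub>"
        using that f by (auto simp: val_def image_subset_iff)
      moreover have "h v \<in> carrier H" "val b \<in> carrier H"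
        using that Cons by (auto intro!: h_closed val)
      ultimately have "val a \<otimes>\<^bsub>H\<^esub> (val b \<otimes>\<^bsub>H\<^esub> h v) = h v"
        using val[OF that(1)] by (simp flip: m_assoc)
      then show ?thesis
        using True Cons by (simp add: h_def)
    next
      case False
      then have "cons_cancel a (b # v) = a # b # v" by auto
      then show ?thesis
        using Cons by (simp add: h_def)
    qed
  qed (simp add: h_def)
  have h_mult: "h (foldr cons_cancel u v) = h u \<otimes>\<^bsub>H\<^esub> h v"
    if "fst ` set u \<subseteq> S" "fst ` set v \<subseteq> S" for u v
    using that
  proof (induction u)
    case Nil
    then show ?case using h_closed by (simp add: h_def)
  next
    case (Cons a u)
    have "fst ` set (foldr cons_cancel u v) \<subseteq> S"
      using letters_foldr[of u v] Cons.prems by fastforce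
    then have "h (foldr cons_cancel (a # u) v) = val a \<otimes>\<^bsub>H\<^esub> (h u \<otimes>\<^bsub>H\<^esub> h v)"
      using Cons by (simp add: h_cc)
    also have "\<dots> = h (a # u) \<otimes>\<^bsub>H\<^esub> h v"
      using Cons.prems h_closed[of u] h_closed[of v] val[of a] by (simp add: h_def m_assoc)
    finally show ?case .
  qed
  show "h \<in> hom (free_group S) H"
    by (rule homI) (auto simp: free_group_def h_closed h_mult)
  show "h (letter x) = f x" if "x \<in> S" for x
    using that f by (auto simp: h_def val_def)
qed

lemma free_Abelian_group_generated:
  "generate (free_Abelian_group S) (frag_of ` S) = carrier (free_Abelian_group S)"
proof
  interpret group "free_Abelian_group S" by simp
  show "generate (free_Abelian_group S) (frag_of ` S) \<subseteq> carrier (free_Abelian_group S)"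
    by (rule generate_incl) auto
  show "carrier (free_Abelian_group S) \<subseteq> generate (free_Abelian_group S) (frag_of ` S)"
  proof
    fix c assume "c \<in> carrier (free_Abelian_group S)"
    then have "Poly_Mapping.keys c \<subseteq> S" by simp
    then show "c \<in> generate (free_Abelian_group S) (frag_of ` S)"
    proof (rule free_Abelian_group_induct)
      show "0 \<in> generate (free_Abelian_group S) (frag_of ` S)"
        using generate.one[of "free_Abelian_group S"] by simp
    next
      fix x y :: "'a \<Rightarrow>\<^sub>0 int"
      assume 2: "Poly_Mapping.keys x \<subseteq> S" "Poly_Mapping.keys y \<subseteq> S"
        "x \<in> generate (free_Abelian_group S) (frag_of ` S)"
        "y \<in> generate (free_Abelian_group S) (frag_of ` S)"
      have "x \<otimes>\<^bsub>free_Abelian_group S\<^esub> inv\<^bsub>free_Abelian_group S\<^esub> y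
              \<in> generate (free_Abelian_group S) (frag_of ` S)"
        using 2 by (intro generate.eng generate_m_inv_closed) auto
      then show "x - y \<in> generate (free_Abelian_group S) (frag_of ` S)"
        using 2 by simp
    qed (auto intro: generate.incl)
  qed
qed


section \<open>Free paratopological groups\<close>

definition paratopological_group :: "('g, 'm) monoid_scheme \<Rightarrow> 'g topology \<Rightarrow> bool" where
  "paratopological_group G T \<longleftrightarrow>
     group G \<and> topspace T = carrier G \<and>
     continuous_map (prod_topology T T) T (\<lambda>(x, y). x \<otimes>\<^bsub>G\<^esub> y)"

text \<open>
  The topology \<open>T\<close> turns \<open>G\<close>, with \<open>X\<close> embedded through \<open>e\<close>, into the free paratopological group
  on \<open>X\<close> within the class \<open>C\<close> of groups; \<open>C\<close> is \<^const>\<open>group\<close> or \<^const>\<open>comm_group\<close>. HOL cannot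
  quantify over types inside a formula, so the test groups \<open>H\<close> live on the type of the elements
  of \<open>G\<close>. This is no restriction: the lemmas \<open>FP_universal\<close> and \<open>AP_universal\<close>
  give the universal property for paratopological groups of any type.
\<close>

definition free_paratopological_group ::
    "('g monoid \<Rightarrow> bool) \<Rightarrow> 'a topology \<Rightarrow> 'g monoid \<Rightarrow> ('a \<Rightarrow> 'g) \<Rightarrow> 'g topology \<Rightarrow> bool" where
  "free_paratopological_group C X G e T \<longleftrightarrow>
     C G \<and> paratopological_group G T \<and> embedding_map X T e \<and>
     generate G (e ` topspace X) = carrier G \<and>
     (\<forall>(H :: 'g monoid) S f.
        C H \<and> paratopological_group H S \<and> continuous_map X S f \<longrightarrow>
        (\<exists>h \<in> hom G H. continuous_map T S h \<and> (\<forall>x \<in> topspace X. h (e x) = f x)))"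

definition FP :: "'a topology \<Rightarrow> 'a word topology" where
  "FP X = (THE T. free_paratopological_group group X (free_group (topspace X)) letter T)"

definition AP :: "'a topology \<Rightarrow> ('a \<Rightarrow>\<^sub>0 int) topology" where
  "AP X = (THE T. free_paratopological_group comm_group X
                    (free_Abelian_group (topspace X)) frag_of T)"

definition FP2 :: "'a topology \<Rightarrow> 'a word topology" where
  "FP2 X = subtopology (FP X) {w. length w \<le> 2}"

text \<open>The reduced length of \<open>n\<^sub>1x\<^sub>1 + \<dots> + n\<^sub>kx\<^sub>k\<close>, with distinct \<open>x\<^sub>i\<close>, is \<open>\<bar>n\<^sub>1\<bar> + \<dots> + \<bar>n\<^sub>k\<bar>\<close>.\<close>

definition frag_length :: "('a \<Rightarrow>\<^sub>0 int) \<Rightarrow> int" where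
  "frag_length c = (\<Sum>x\<in>Poly_Mapping.keys c. \<bar>Poly_Mapping.lookup c x\<bar>)"

definition AP2 :: "'a topology \<Rightarrow> ('a \<Rightarrow>\<^sub>0 int) topology" where
  "AP2 X = subtopology (AP X) {c. frag_length c \<le> 2}"


section \<open>Bounded subsets and mu-spaces\<close>

definition bounded_in :: "'a topology \<Rightarrow> 'a set \<Rightarrow> bool" where
  "bounded_in Z A \<longleftrightarrow>
     A \<subseteq> topspace Z \<and> (\<forall>f. continuous_map Z euclideanreal f \<longrightarrow> bounded (f ` A))"

definition mu_space :: "'a topology \<Rightarrow> bool" where
  "mu_space Z \<longleftrightarrow> (\<forall>A. bounded_in Z A \<longrightarrow> compactin Z (Z closure_of A))"


section \<open>Existence, uniqueness and universal property\<close>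

lemma continuous_map_from_embedding: "embedding_map X T e \<Longrightarrow> continuous_map X T e"
  unfolding embedding_map_def
  using continuous_map_in_subtopology homeomorphic_imp_continuous_map by blast

lemma paratopological_group_pullback:
  assumes G: "group G" and H: "paratopological_group H S" and h: "h \<in> hom G H"
  shows "paratopological_group G (pullback_topology (carrier G) h S)" (is "paratopological_group G ?T")
proof -
  interpret group G by fact
  have hc: "h x \<in> carrier H" if "x \<in> carrier G" for x
    using h that by (auto simp: hom_def)
  have S: "topspace S = carrier H"
    using H by (simp add: paratopological_group_def)
  have top: "topspace ?T = carrier G"
    using hc S by (auto simp: topspace_pullback_topology)
  have hcont: "continuous_map ?T S h"
    using continuous_map_pullback[of S S id "carrier G" h] by simp
  have "continuous_map (prod_topology ?T ?T) S ((\<lambda>(x, y). x \<otimes>\<^bsub>H\<^esub> y) \<circ> (\<lambda>(x, y). (h x, h y)))"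
  proof (rule continuous_map_compose)
    show "continuous_map (prod_topology ?T ?T) (prod_topology S S) (\<lambda>(x, y). (h x, h y))"
      by (auto simp: case_prod_unfold
          intro!: continuous_intros continuous_map_compose[OF continuous_map_fst hcont, unfolded o_def]
                  continuous_map_compose[OF continuous_map_snd hcont, unfolded o_def])
  qed (use H in \<open>auto simp: paratopological_group_def\<close>)
  then have "continuous_map (prod_topology ?T ?T) S (h \<circ> (\<lambda>(x, y). x \<otimes>\<^bsub>G\<^esub> y))"
    by (rule continuous_map_eq) (use h top in \<open>auto simp: hom_def\<close>)
  then have "continuous_map (prod_topology ?T ?T) ?T (\<lambda>(x, y). x \<otimes>\<^bsub>G\<^esub> y)"
    by (rule continuous_map_pullback') (auto simp: top)
  with top G show ?thesis
    by (simp add: paratopological_group_def)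
qed

lemma hom_eq_id_on_generate:
  assumes G: "group G" and h: "h \<in> hom G G" and A: "A \<subseteq> carrier G" "\<And>a. a \<in> A \<Longrightarrow> h a = a"
    and "x \<in> generate G A"
  shows "h x = x"
proof -
  interpret group_hom G G h
    using G h by (simp add: group_hom_def group_hom_axioms_def)
  have "x \<in> carrier G \<and> h x = x"
    using \<open>x \<in> generate G A\<close> by induction (use A in \<open>auto simp: subset_iff\<close>)
  then show ?thesis ..
qed

lemma free_paratopological_group_finest:
  assumes F: "free_paratopological_group C X G e T" and T': "paratopological_group G T'"
    and e: "continuous_map X T' e"
  shows "continuous_map T T' (\<lambda>x. x)"
proof -
  have C: "C G" and T: "paratopological_group G T" and gen: "generate G (e ` topspace X) = carrier G"
    using F by (auto simp: free_paratopological_group_def)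
  obtain h where h: "h \<in> hom G G" "continuous_map T T' h" "\<And>x. x \<in> topspace X \<Longrightarrow> h (e x) = e x"
    using F C T' e unfolding free_paratopological_group_def by blast
  have grp: "group G" and top: "topspace T = carrier G"
    using T by (auto simp: paratopological_group_def)
  have "e ` topspace X \<subseteq> carrier G"
    using e T' by (auto simp: paratopological_group_def continuous_map_def)
  then have "h x = x" if "x \<in> topspace T" for x
    using hom_eq_id_on_generate[OF grp h(1), of "e ` topspace X" x] h(3) that gen top by auto
  then show ?thesis
    by (rule continuous_map_eq[OF h(2)])
qed

lemma free_paratopological_group_continuous_hom:
  assumes F: "free_paratopological_group C X G e T" and H: "paratopological_group H S"
    and h: "h \<in> hom G H" and he: "continuous_map X S (\<lambda>x. h (e x))"
  shows "continuous_map T S h"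
proof -
  let ?T = "pullback_topology (carrier G) h S"
  have G: "group G" "topspace T = carrier G" and emb: "embedding_map X T e"
    using F by (auto simp: free_paratopological_group_def paratopological_group_def)
  have "e ` topspace X \<subseteq> carrier G"
    using continuous_map_from_embedding[OF emb] G by (auto simp: continuous_map_def)
  then have "continuous_map X ?T e"
    using he by (intro continuous_map_pullback') (auto simp: o_def)
  then have "continuous_map T ?T (\<lambda>x. x)"
    using free_paratopological_group_finest[OF F] paratopological_group_pullback[OF G(1) H h] by blast
  moreover have "continuous_map ?T S h"
    using continuous_map_pullback[of S S id "carrier G" h] by simp
  ultimately show ?thesis
    using continuous_map_compose[of T ?T "\<lambda>x. x" S h] by (simp add: o_def)
qed

lemma free_paratopological_group_unique:
  assumes "free_paratopological_group C X G e T" "free_paratopological_group C X G e T'"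
  shows "T = T'"
proof -
  have T: "paratopological_group G T" "continuous_map X T e"
    and T': "paratopological_group G T'" "continuous_map X T' e"
    using assms by (simp_all add: free_paratopological_group_def continuous_map_from_embedding)
  have "continuous_map T T' id" "continuous_map T' T id"
    unfolding id_def
    by (rule free_paratopological_group_finest[OF assms(1) T'],
        rule free_paratopological_group_finest[OF assms(2) T])
  moreover have "topspace T = topspace T'"
    using T(1) T'(1) by (simp add: paratopological_group_def)
  ultimately have "\<forall>U. openin T U \<longrightarrow> openin T' U" "\<forall>U. openin T' U \<longrightarrow> openin T U"
    by (simp_all add: topology_finer_continuous_id)
  then show ?thesis
    unfolding topology_eq by blast
qed

definition upper_int :: "int topology" where
  "upper_int = topology_generated_by (range atLeast)"

lemma topspace_upper_int [simp]: "topspace upper_int = UNIV"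
  by (auto simp: upper_int_def)

lemma openin_upper_int_atLeast: "openin upper_int {n..}"
  by (simp add: upper_int_def topology_generated_by_Basis)

lemma paratopological_group_upper_int: "paratopological_group integer_group upper_int"
proof -
  have "openin (prod_topology upper_int upper_int) ((\<lambda>(x, y). x + y) -` {n..})" for n :: int
  proof -
    have "(a, b) \<in> (\<Union>k. {k..} \<times> {n - k..}) \<longleftrightarrow> n \<le> a + b" for a b :: int
      by (auto simp: algebra_simps intro: exI[of _ a])
    then have "(\<lambda>(x, y). x + y) -` {n..} = (\<Union>k. {k..} \<times> {n - k..})"
      by auto
    also have "openin (prod_topology upper_int upper_int) \<dots>"
      by (intro openin_Union) (auto simp: openin_prod_Times_iff openin_upper_int_atLeast)
    finally show ?thesis .
  qed
  then have "continuous_map (prod_topology upper_int upper_int)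
               (topology_generated_by (range atLeast)) (\<lambda>(x, y). x + y :: int)"
    by (intro continuous_on_generated_topo) (auto intro: atLeast_iff[THEN iffD2])
  then have "continuous_map (prod_topology upper_int upper_int) upper_int (\<lambda>(x, y). x + y)"
    by (simp add: upper_int_def)
  then show ?thesis
    by (simp add: paratopological_group_def)
qed

lemma continuous_map_upper_int_indicator:
  assumes "openin X U"
  shows "continuous_map X upper_int (\<lambda>x. if x \<in> U then 1 else 0)"
  unfolding upper_int_def
proof (rule continuous_on_generated_topo)
  fix V :: "int set" assume "V \<in> range atLeast"
  then obtain n where V: "V = {n..}" by auto
  have "(\<lambda>x. if x \<in> U then 1 else 0) -` V \<inter> topspace X
          = (if n \<le> 0 then topspace X else if n \<le> 1 then U else {})"
    using openin_subset[OF assms] V by auto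
  then show "openin X ((\<lambda>x. if x \<in> U then 1 else 0) -` V \<inter> topspace X)"
    using assms by simp
qed auto

lemma free_paratopological_group_ex1:
  fixes G :: "'g monoid"
  assumes C: "C G" "\<And>H. C H \<Longrightarrow> group H"
    and gen: "generate G (e ` topspace X) = carrier G" and inj: "inj_on e (topspace X)"
    and ext: "\<And>(H :: 'g monoid) f. C H \<Longrightarrow> f ` topspace X \<subseteq> carrier H \<Longrightarrow>
                \<exists>h \<in> hom G H. \<forall>x\<in>topspace X. h (e x) = f x"
    and ext_int: "\<And>f. \<exists>h \<in> hom G integer_group. \<forall>x\<in>topspace X. h (e x) = f x"
  shows "\<exists>!T. free_paratopological_group C X G e T"
proof -
  define adm where "adm T \<longleftrightarrow> paratopological_group G T \<and> continuous_map X T e" for T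
  define T where "T = topology_generated_by {U. \<exists>T'. adm T' \<and> openin T' U}"
  have G: "group G" using C by blast
  have e_in: "e ` topspace X \<subseteq> carrier G"
    unfolding gen[symmetric] by (auto intro: generate.incl)
  have adm_pullback: "adm (pullback_topology (carrier G) h S)"
    if "paratopological_group H S" "h \<in> hom G H" "continuous_map X S (\<lambda>x. h (e x))"
    for H :: "('h, 'k) monoid_scheme" and S h
    using paratopological_group_pullback[OF G that(1,2)] that(3) e_in
    by (auto simp: adm_def o_def intro!: continuous_map_pullback')
  have adm_top: "topspace T' = carrier G" if "adm T'" for T'
    using that by (simp add: adm_def paratopological_group_def)
  obtain h0 where h0: "h0 \<in> hom G integer_group" "\<And>x. x \<in> topspace X \<Longrightarrow> h0 (e x) = 0"
    using ext_int[of "\<lambda>_. 0"] by auto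
  have "continuous_map X upper_int (\<lambda>x. h0 (e x))"
    by (rule continuous_map_eq[of _ _ "\<lambda>_. 0"]) (auto simp: h0)
  from adm_pullback[OF paratopological_group_upper_int h0(1) this]
  obtain T0 where T0: "adm T0" by blast
  have top: "topspace T = carrier G"
  proof -
    have "U \<subseteq> carrier G" if "adm T'" "openin T' U" for T' U
      using openin_subset[OF that(2)] adm_top[OF that(1)] by simp
    moreover have "openin T0 (carrier G)"
      using openin_topspace[of T0] adm_top[OF T0] by simp
    ultimately have "\<Union> {U. \<exists>T'. adm T' \<and> openin T' U} = carrier G"
      using T0 by blast
    then show ?thesis by (simp add: T_def)
  qed
  have sub: "openin T U" if "adm T'" "openin T' U" for T' U
    unfolding T_def by (rule topology_generated_by_Basis) (use that in auto)
  have fine: "continuous_map T T' (\<lambda>x. x)" if "adm T'" for T'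
  proof -
    have "continuous_map T T' id"
      using topology_finer_continuous_id[of T' T] top adm_top[OF that] sub[OF that] by simp
    then show ?thesis by (simp add: id_def)
  qed
  have into: "continuous_map Z T f"
    if "\<And>T'. adm T' \<Longrightarrow> continuous_map Z T' f" for Z :: "'z topology" and f
    unfolding T_def
  proof (rule continuous_on_generated_topo)
    show "openin Z (f -` U \<inter> topspace Z)" if U: "U \<in> {U. \<exists>T'. adm T' \<and> openin T' U}" for U
    proof -
      obtain T' where "adm T'" "openin T' U" using U by blast
      then show ?thesis
        using \<open>\<And>T'. adm T' \<Longrightarrow> continuous_map Z T' f\<close>[of T'] unfolding continuous_map_alt by blast
    qed
    have "f ` topspace Z \<subseteq> topspace T0"
      using that[OF T0] by (auto simp: continuous_map_def)
    then show "f ` topspace Z \<subseteq> \<Union> {U. \<exists>T'. adm T' \<and> openin T' U}"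
      using T0 openin_topspace by blast
  qed
  have para: "paratopological_group G T"
    unfolding paratopological_group_def
  proof (intro conjI G top into)
    fix T' assume T': "adm T'"
    have "continuous_map (prod_topology T T) T' ((\<lambda>(x, y). x \<otimes>\<^bsub>G\<^esub> y) \<circ> (\<lambda>(x, y). (x, y)))"
    proof (rule continuous_map_compose)
      show "continuous_map (prod_topology T T) (prod_topology T' T') (\<lambda>(x, y). (x, y))"
        by (auto simp: case_prod_unfold simp del: prod.collapse
            intro!: continuous_intros
              continuous_map_compose[OF continuous_map_fst fine[OF T'], unfolded o_def]
              continuous_map_compose[OF continuous_map_snd fine[OF T'], unfolded o_def])
    qed (use T' in \<open>auto simp: adm_def paratopological_group_def\<close>)
    then show "continuous_map (prod_topology T T) T' (\<lambda>(x, y). x \<otimes>\<^bsub>G\<^esub> y)"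
      by (simp add: o_def case_prod_unfold)
  qed
  have econt: "continuous_map X T e"
    by (rule into) (simp add: adm_def)
  have emb: "embedding_map X T e"
    unfolding embedding_map_def
  proof (rule bijective_open_imp_homeomorphic_map)
    show "continuous_map X (subtopology T (e ` topspace X)) e"
      using econt by (simp add: continuous_map_in_subtopology image_subset_iff_funcset)
    show "e ` topspace X = topspace (subtopology T (e ` topspace X))"
      using e_in top by auto
    show "inj_on e (topspace X)" by (rule inj)
    show "open_map X (subtopology T (e ` topspace X)) e"
      unfolding open_map_def
    proof (intro allI impI)
      fix U assume U: "openin X U"
      obtain h where h: "h \<in> hom G integer_group"
        "\<And>x. x \<in> topspace X \<Longrightarrow> h (e x) = (if x \<in> U then 1 else 0)"
        using ext_int[of "\<lambda>x. if x \<in> U then 1 else 0"] by blast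
      have "continuous_map X upper_int (\<lambda>x. h (e x))"
        by (rule continuous_map_eq[OF continuous_map_upper_int_indicator[OF U]]) (simp add: h)
      then have "adm (pullback_topology (carrier G) h upper_int)"
        by (rule adm_pullback[OF paratopological_group_upper_int h(1)])
      then have op: "openin T (h -` {1..} \<inter> carrier G)"
        by (rule sub) (use openin_upper_int_atLeast in \<open>auto simp: openin_pullback_topology\<close>)
      have "1 \<le> h (e x) \<longleftrightarrow> x \<in> U" if "x \<in> topspace X" for x
        using h(2)[OF that] by simp
      then have "e ` U = (h -` {1..} \<inter> carrier G) \<inter> e ` topspace X"
        using openin_subset[OF U] e_in by auto
      then show "openin (subtopology T (e ` topspace X)) (e ` U)"
        unfolding openin_subtopology using op by blast
    qed
  qed
  have "free_paratopological_group C X G e T"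
    unfolding free_paratopological_group_def
  proof (intro conjI allI impI C para emb gen)
    fix H :: "'g monoid" and S f
    assume H: "C H \<and> paratopological_group H S \<and> continuous_map X S f"
    then have "f ` topspace X \<subseteq> carrier H"
      by (auto simp: paratopological_group_def continuous_map_def)
    then obtain h where h: "h \<in> hom G H" "\<And>x. x \<in> topspace X \<Longrightarrow> h (e x) = f x"
      using ext[of H f] H by blast
    have "continuous_map X S (\<lambda>x. h (e x))"
      by (rule continuous_map_eq[of _ _ f]) (use H h in auto)
    then have "adm (pullback_topology (carrier G) h S)"
      using adm_pullback H h by blast
    from fine[OF this] have "continuous_map T S h"
      using continuous_map_compose[of T "pullback_topology (carrier G) h S" "\<lambda>x. x" S h]
        continuous_map_pullback[of S S id "carrier G" h] by (simp add: o_def)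
    with h show "\<exists>h\<in>hom G H. continuous_map T S h \<and> (\<forall>x\<in>topspace X. h (e x) = f x)"
      by blast
  qed
  then show ?thesis
    using free_paratopological_group_unique by blast
qed

theorem FP_free:
  "free_paratopological_group group X (free_group (topspace X)) letter (FP X)"
  unfolding FP_def
proof (rule theI', rule free_paratopological_group_ex1)
  fix H :: "'a word monoid" and f
  assume "group H" "f ` topspace X \<subseteq> carrier H"
  then show "\<exists>h \<in> hom (free_group (topspace X)) H. \<forall>x\<in>topspace X. h (letter x) = f x"
    using free_group_universal by metis
next
  fix f :: "'a \<Rightarrow> int"
  show "\<exists>h \<in> hom (free_group (topspace X)) integer_group. \<forall>x\<in>topspace X. h (letter x) = f x"
    using free_group_universal[OF group_integer_group, of f] by (metis carrier_integer_group subset_UNIV)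
qed (auto simp: group_free_group free_group_generated inj_on_def)

theorem AP_free:
  "free_paratopological_group comm_group X (free_Abelian_group (topspace X)) frag_of (AP X)"
  unfolding AP_def
proof (rule theI', rule free_paratopological_group_ex1)
  fix H :: "('a \<Rightarrow>\<^sub>0 int) monoid" and f
  assume "comm_group H" "f ` topspace X \<subseteq> carrier H"
  then show "\<exists>h \<in> hom (free_Abelian_group (topspace X)) H. \<forall>x\<in>topspace X. h (frag_of x) = f x"
    using comm_group.free_Abelian_group_universal by metis
next
  fix f :: "'a \<Rightarrow> int"
  show "\<exists>h \<in> hom (free_Abelian_group (topspace X)) integer_group.
          \<forall>x\<in>topspace X. h (frag_of x) = f x"
    using comm_group.free_Abelian_group_universal[OF abelian_integer_group, of f]
    by (metis carrier_integer_group subset_UNIV)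
qed (auto simp: abelian_free_Abelian_group comm_group.axioms free_Abelian_group_generated
       inj_on_def frag_of_eq)

theorem FP_universal:
  assumes H: "paratopological_group H S" and f: "continuous_map X S f"
  obtains h where "h \<in> hom (free_group (topspace X)) H" "continuous_map (FP X) S h"
    "\<And>x. x \<in> topspace X \<Longrightarrow> h (letter x) = f x"
proof -
  have "group H" "f ` topspace X \<subseteq> carrier H"
    using H f by (auto simp: paratopological_group_def continuous_map_def)
  then obtain h where h: "h \<in> hom (free_group (topspace X)) H"
      "\<And>x. x \<in> topspace X \<Longrightarrow> h (letter x) = f x"
    by (rule free_group_universal) auto
  have "continuous_map X S (\<lambda>x. h (letter x))"
    by (rule continuous_map_eq[OF f]) (simp add: h)
  then show thesis
    using that h free_paratopological_group_continuous_hom[OF FP_free H h(1)] by blast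
qed

theorem AP_universal:
  assumes "comm_group H" and H: "paratopological_group H S" and f: "continuous_map X S f"
  obtains h where "h \<in> hom (free_Abelian_group (topspace X)) H" "continuous_map (AP X) S h"
    "\<And>x. x \<in> topspace X \<Longrightarrow> h (frag_of x) = f x"
proof -
  have "f ` topspace X \<subseteq> carrier H"
    using H f by (auto simp: paratopological_group_def continuous_map_def)
  then obtain h where h: "h \<in> hom (free_Abelian_group (topspace X)) H"
      "\<And>x. x \<in> topspace X \<Longrightarrow> h (frag_of x) = f x"
    by (rule comm_group.free_Abelian_group_universal[OF \<open>comm_group H\<close>]) auto
  have "continuous_map X S (\<lambda>x. h (frag_of x))"
    by (rule continuous_map_eq[OF f]) (simp add: h)
  then show thesis
    using that h free_paratopological_group_continuous_hom[OF AP_free H h(1)] by blast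
qed

end

theory Submission
  imports Defs
begin

text \<open>
  Every continuous real function on \<open>X\<close> extends to a continuous homomorphism into the additive
  reals. The one extending the constant \<open>1\<close> shows that \<open>X\<close> is closed in \<open>AP\<^sub>2(X)\<close> (or
  \<open>FP\<^sub>2(X)\<close>): by parity, the generators are the only words of length at most \<open>2\<close> and degree \<open>1\<close>.
  So \<open>X\<close> is locally compact, hence completely regular.

  Let \<open>K\<close> be a compact neighbourhood of the neutral element. Every point \<open>y\<close> has a neighbourhood
  \<open>V\<^sub>y\<close> with \<open>V\<^sub>y - y \<subseteq> K\<close>. If the set \<open>X'\<close> of non-isolated points were unbounded in \<open>X\<close>, bump
  functions at points close to a discrete sequence \<open>y\<^sub>n\<close> in \<open>X'\<close> would add up to a continuous
  \<open>g\<close> with \<open>g(x\<^sub>n) - g(y\<^sub>n) = n\<close> for some \<open>x\<^sub>n\<close> in \<open>V\<^sub>y\<close>, \<open>y = y\<^sub>n\<close>, and the homomorphism extending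
  \<open>g\<close> would be unbounded on \<open>K\<close>. So \<open>X'\<close> is bounded, hence compact, and any closed compact
  neighbourhood of \<open>X'\<close> is clopen with discrete complement.
\<close>

section \<open>Spaces whose non-isolated points form a compact set\<close>

text \<open>Points outside the derived set are isolated, so such a set is a union of open
  singletons.\<close>

lemma openin_disjoint_derived_set:
  assumes "S \<subseteq> topspace X" "S \<inter> X derived_set_of topspace X = {}"
  shows "openin X S"
proof (subst openin_subopen, intro ballI)
  fix x assume x: "x \<in> S"
  with assms have "x \<in> topspace X" "x \<notin> X derived_set_of topspace X"
    by auto
  then obtain U where U: "x \<in> U" "openin X U" "\<And>y. y \<in> topspace X \<Longrightarrow> y \<in> U \<Longrightarrow> y = x"
    by (auto simp: derived_set_of_def)
  then have "U = {x}"
    using openin_subset[OF U(2)] by auto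
  with U x show "\<exists>U. openin X U \<and> x \<in> U \<and> U \<subseteq> S"
    by blast
qed

lemma homeomorphic_space_clopen_sum:
  fixes X :: "'a topology"
  assumes L: "openin X L" and M: "openin X (topspace X - L)"
  shows "X homeomorphic_space
           sum_topology (\<lambda>b. if b then subtopology X L else subtopology X (topspace X - L)) (UNIV :: bool set)"
    (is "_ homeomorphic_space ?S")
proof -
  have "homeomorphic_map X ?S (\<lambda>x. (x \<in> L, x))"
  proof (rule bijective_open_imp_homeomorphic_map)
    show "continuous_map X ?S (\<lambda>x. (x \<in> L, x))"
      unfolding continuous_map
    proof (intro conjI allI impI)
      fix U assume "openin ?S U"
      then have "openin (subtopology X L) {x. (True, x) \<in> U}"
        "openin (subtopology X (topspace X - L)) {x. (False, x) \<in> U}"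
        by (auto simp: openin_sum_topology all_bool_eq)
      then have sub: "openin X {x. (True, x) \<in> U}" "{x. (True, x) \<in> U} \<subseteq> L"
        "openin X {x. (False, x) \<in> U}" "{x. (False, x) \<in> U} \<subseteq> topspace X - L"
        using L M by (simp_all add: openin_open_subtopology)
      have "{x \<in> topspace X. (x \<in> L, x) \<in> U} = {x. (True, x) \<in> U} \<union> {x. (False, x) \<in> U}"
      proof (intro Set.set_eqI)
        show "x \<in> {x \<in> topspace X. (x \<in> L, x) \<in> U} \<longleftrightarrow> x \<in> {x. (True, x) \<in> U} \<union> {x. (False, x) \<in> U}"
          for x
          using sub openin_subset[OF L] by (cases "x \<in> L") auto
      qed
      with sub show "openin X {x \<in> topspace X. (x \<in> L, x) \<in> U}"
        by auto
    qed auto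
    show "open_map X ?S (\<lambda>x. (x \<in> L, x))"
      unfolding open_map_def
    proof (intro allI impI)
      fix U assume U: "openin X U"
      have "{x. (True, x) \<in> (\<lambda>x. (x \<in> L, x)) ` U} = U \<inter> L"
        "{x. (False, x) \<in> (\<lambda>x. (x \<in> L, x)) ` U} = U \<inter> (topspace X - L)"
        using openin_subset[OF U] by auto
      then show "openin ?S ((\<lambda>x. (x \<in> L, x)) ` U)"
        using openin_subset[OF U] U
        by (auto simp: openin_sum_topology all_bool_eq openin_subtopology_Int)
    qed
    show "(\<lambda>x. (x \<in> L, x)) ` topspace X = topspace ?S"
      using openin_subset[OF L] by (auto split: if_splits)
  qed (auto simp: inj_on_def)
  then show ?thesis
    by (rule homeomorphic_map_imp_homeomorphic_space)
qed

text \<open>Local compactness gives an open \<open>U\<close> and a closed compact \<open>L\<close>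
  with \<open>?D\<close> \<subseteq> \<open>U\<close> \<subseteq> \<open>L\<close>. The points of
  \<open>L - U\<close> are isolated, so \<open>L\<close> is also open, and every point off
  \<open>L\<close> is isolated.\<close>

lemma homeomorphic_compact_discrete_sum:
  fixes X :: "'a topology"
  assumes "Hausdorff_space X" "locally_compact_space X"
    and "compactin X (X derived_set_of topspace X)" (is "compactin X ?D")
  shows "\<exists>(K :: 'a topology) (D :: 'a topology).
           compact_space K \<and> D = discrete_topology (topspace D) \<and>
           X homeomorphic_space sum_topology (\<lambda>b. if b then K else D) (UNIV :: bool set)"
proof -
  obtain U L where U: "openin X U" "?D \<subseteq> U" "U \<subseteq> L" and L: "compactin X L" "closedin X L"
    using assms locally_compact_space_compact_closed_compact by metis
  have "openin X (L - U)"
    using closedin_subset[OF L(2)] U by (intro openin_disjoint_derived_set) auto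
  then have "openin X (U \<union> (L - U))"
    using U by blast
  then have Lo: "openin X L"
    using U by (simp add: Un_absorb1)
  have iso: "openin X S" if "S \<subseteq> topspace X - L" for S
    using that U by (intro openin_disjoint_derived_set) auto
  have "subtopology X (topspace X - L) = discrete_topology (topspace X - L)"
  proof (rule sym, subst discrete_topology_unique, intro conjI ballI)
    fix x assume "x \<in> topspace X - L"
    then show "openin (subtopology X (topspace X - L)) {x}"
      using iso by (simp add: openin_open_subtopology)
  qed auto
  moreover have "compact_space (subtopology X L)"
    using L by (simp add: compact_space_subtopology)
  ultimately show ?thesis
    using homeomorphic_space_clopen_sum[OF Lo iso[OF subset_refl]]
    by (metis topspace_discrete_topology)
qed

text \<open>Here \<open>V\<close> is any assignment of neighbourhoods to the non-isolated points. As
  \<open>f\<close> is unbounded on these points, some of them have rapidly growing values of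
  \<open>\<bar>f\<bar>\<close>, and bumps placed near them form a locally finite sum.\<close>

lemma unbounded_oscillation_near_nonisolated:
  fixes X :: "'a topology"
  assumes cr: "completely_regular_space X" and t1: "t1_space X"
    and f: "continuous_map X euclideanreal f"
    and unb: "\<not> bounded (f ` (X derived_set_of topspace X))"
    and V: "\<And>y. y \<in> X derived_set_of topspace X \<Longrightarrow> openin X (V y)" "\<And>y. y \<in> X derived_set_of topspace X \<Longrightarrow> y \<in> V y"
  obtains x y :: "nat \<Rightarrow> 'a" and g where "continuous_map X euclideanreal g"
    "\<And>n. y n \<in> X derived_set_of topspace X" "\<And>n. x n \<in> V (y n)" "\<And>n. g (x n) - g (y n) = real n"
proof -
  let ?D = "X derived_set_of topspace X"
  define F where "F x = \<bar>f x\<bar>" for x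
  have F: "continuous_map X euclideanreal F"
    unfolding F_def using f by (rule continuous_map_real_abs)
  have big: "\<exists>y. y \<in> ?D \<and> c < F y" for c
    using unb by (force simp: bounded_iff F_def not_le)
  \<comment> \<open>Steps larger than 2 keep the intervals of radius 1 around the values
    \<open>F (y n)\<close> disjoint, and with them the sets \<open>N n\<close>.\<close>
  have "\<exists>y. \<forall>n. y n \<in> ?D \<and> F (y n) + 2 < F (y (Suc n))"
    by (rule dependent_nat_choice) (use big in blast)+
  then obtain y where y: "\<And>n. y n \<in> ?D" and step: "\<And>n. F (y n) + 2 < F (y (Suc n))"
    by blast
  have gap: "F (y m) + 2 < F (y n)" if "m < n" for m n
    using that
  proof (induction n)
    case (Suc n)
    then show ?case
      using step[of n] by (cases "m = n") auto
  qed simp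
  \<comment> \<open>This makes the family \<open>N n\<close> locally finite: for n \<ge> 1, on
    \<open>N n\<close> the function \<open>F\<close> exceeds 2n - 1 \<ge> n, so only finitely many
    of these sets meet the region \<open>F < k\<close>.\<close>
  have grow: "2 * real n \<le> F (y n)" for n
  proof (induction n)
    case (Suc n)
    then show ?case
      using step[of n] by simp
  qed (simp add: F_def)
  define N where "N n = {x \<in> topspace X. F x \<in> {F (y n) - 1 <..< F (y n) + 1}}" for n
  have N: "openin X (N n)" for n
    unfolding N_def by (rule openin_continuous_map_preimage[OF F]) auto
  have yX: "y n \<in> topspace X" for n
    using y[of n] by (simp add: derived_set_of_def)
  have yN: "y n \<in> N n" for n
    using yX by (simp add: N_def)
  have "\<exists>x. x \<noteq> y n \<and> x \<in> V (y n) \<and> x \<in> N n" for n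
  proof -
    have "openin X (V (y n) \<inter> N n)" "y n \<in> V (y n) \<inter> N n"
      using V y N yX by (auto simp: N_def)
    then show ?thesis
      using y[of n] by (auto simp: derived_set_of_def)
  qed
  then obtain x where x: "\<And>n. x n \<noteq> y n" "\<And>n. x n \<in> V (y n)" "\<And>n. x n \<in> N n"
    by metis
  \<comment> \<open>Deleting \<open>y n\<close> from \<open>N n\<close> forces the bump to vanish at
    \<open>y n\<close>, so the difference of its values at \<open>x n\<close> and \<open>y n\<close>
    is exactly n.\<close>
  have "\<exists>b. continuous_map X euclideanreal b \<and> b (x n) = real n \<and> (\<forall>z \<in> topspace X. z \<notin> N n - {y n} \<longrightarrow> b z = 0)"
    for n
  proof -
    have "openin X (N n - {y n})" "x n \<in> N n - {y n}"
      using t1 N[of n] yN[of n] x by (auto simp: t1_space_openin_delete)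
    then obtain b where b: "continuous_map X euclideanreal b" "b (x n) = 0"
        "b ` (topspace X - (N n - {y n})) \<subseteq> {1}"
      using cr unfolding completely_regular_space_alt' by metis
    \<comment> \<open>The separating function is 0 at \<open>x n\<close> and 1 off the open set;
      \<open>1 - b\<close> swaps the two values and the factor scales the bump to n.\<close>
    then show ?thesis
      by (intro exI[of _ "\<lambda>z. real n * (1 - b z)"]) (auto intro!: continuous_intros)
  qed
  then obtain b where b: "\<And>n. continuous_map X euclideanreal (b n)" "\<And>n. b n (x n) = real n"
      and b0: "\<And>n z. z \<in> topspace X \<Longrightarrow> z \<notin> N n - {y n} \<Longrightarrow> b n z = 0"
    by metis
  \<comment> \<open>The sum of all bumps at \<open>z\<close>: the cut-off depends on
    \<open>z\<close>, and any larger one gives the same value.\<close>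
  define g where "g z = (\<Sum>n\<le>nat \<lceil>F z\<rceil>. b n z)" for z
  have vanish: "b n z = 0" if "z \<in> topspace X" "F z \<le> real k" "k < n" for n k z
    using that grow[of n] by (intro b0) (auto simp: N_def)
  have g_eq: "g z = (\<Sum>n\<le>k. b n z)" if "z \<in> topspace X" "F z \<le> real k" for z k
  proof -
    have "nat \<lceil>F z\<rceil> \<le> k"
      using that by linarith
    then have "(\<Sum>n\<le>nat \<lceil>F z\<rceil>. b n z) = (\<Sum>n\<le>k. b n z)"
      using that vanish[of z "nat \<lceil>F z\<rceil>"]
      by (intro sum.mono_neutral_left) (auto simp: not_le real_nat_ceiling_ge)
    then show ?thesis
      by (simp add: g_def)
  qed
  have g_N: "g z = b k z" if z: "z \<in> N k" for z k
  proof -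
    have zX: "z \<in> topspace X"
      using z by (simp add: N_def)
    have zero: "b n z = 0" if "n \<noteq> k" for n
    proof (rule b0[OF zX])
      show "z \<notin> N n - {y n}"
        using z gap[of n k] gap[of k n] that by (cases n k rule: linorder_cases) (auto simp: N_def)
    qed
    define m where "m = max k (nat \<lceil>F z\<rceil>)"
    have "F z \<le> real m"
      unfolding m_def by linarith
    then have "g z = (\<Sum>n\<le>m. b n z)"
      by (rule g_eq[OF zX])
    also have "\<dots> = (\<Sum>n\<in>{k}. b n z)"
      using zero by (intro sum.mono_neutral_right) (auto simp: m_def)
    finally show ?thesis
      by simp
  qed
  \<comment> \<open>On each open set \<open>F < k\<close> the function is a fixed finite sum of
    bumps, and these sets cover the space.\<close>
  have "continuous_map X euclideanreal g"
  proof (rule pasting_lemma[where I = UNIV and T = "\<lambda>k. {z \<in> topspace X. F z \<in> {..<real k}}"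
        and f = "\<lambda>k z. \<Sum>n\<le>k. b n z"])
    show "openin X {z \<in> topspace X. F z \<in> {..<real k}}" for k
      by (rule openin_continuous_map_preimage[OF F]) auto
    show "continuous_map (subtopology X {z \<in> topspace X. F z \<in> {..<real k}}) euclideanreal
            (\<lambda>z. \<Sum>n\<le>k. b n z)" for k
      by (intro continuous_map_from_subtopology continuous_map_sum b) auto
    show "\<exists>k. k \<in> UNIV \<and> z \<in> {z \<in> topspace X. F z \<in> {..<real k}} \<and> g z = (\<Sum>n\<le>k. b n z)"
      if "z \<in> topspace X" for z
    proof -
      obtain k where "F z < real k"
        using reals_Archimedean2 by blast
      then show ?thesis
        using that g_eq[of z k] by auto
    qed
  qed (auto simp flip: g_eq)
  moreover have "g (x n) - g (y n) = real n" for n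
    using g_N[OF x(3)] g_N[OF yN] b(2) b0[OF yX, of n n] by simp
  ultimately show thesis
    using that y x(2) by blast
qed


section \<open>Real-valued homomorphisms\<close>

definition real_group :: "real monoid" where
  "real_group = \<lparr>carrier = UNIV, monoid.mult = (+), one = 0\<rparr>"

lemma real_group_simps [simp]:
  "carrier real_group = UNIV" "x \<otimes>\<^bsub>real_group\<^esub> y = x + y" "\<one>\<^bsub>real_group\<^esub> = 0"
  by (simp_all add: real_group_def)

lemma comm_group_real_group: "comm_group real_group"
proof (rule comm_groupI)
  show "\<exists>y\<in>carrier real_group. y \<otimes>\<^bsub>real_group\<^esub> x = \<one>\<^bsub>real_group\<^esub>" for x
    by (rule bexI[of _ "- x"]) simp_all
qed simp_all

lemma group_real_group: "group real_group"
  using comm_group_real_group by (rule comm_group.axioms)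

lemma inv_real_group [simp]: "inv\<^bsub>real_group\<^esub> x = - x"
  by (rule group.inv_equality[OF group_real_group]) auto

lemma paratopological_group_real_group: "paratopological_group real_group euclideanreal"
  by (auto simp: paratopological_group_def group_real_group case_prod_unfold
      intro!: continuous_intros)

lemma real_hom_simps:
  assumes "group G" "h \<in> hom G real_group"
  shows "h \<one>\<^bsub>G\<^esub> = 0"
    and "x \<in> carrier G \<Longrightarrow> h (inv\<^bsub>G\<^esub> x) = - h x"
    and "x \<in> carrier G \<Longrightarrow> y \<in> carrier G \<Longrightarrow> h (x \<otimes>\<^bsub>G\<^esub> y) = h x + h y"
proof -
  interpret group_hom G real_group h
    using assms group_real_group by (simp add: group_hom_def group_hom_axioms_def)
  show "h \<one>\<^bsub>G\<^esub> = 0" "x \<in> carrier G \<Longrightarrow> h (inv\<^bsub>G\<^esub> x) = - h x"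
    "x \<in> carrier G \<Longrightarrow> y \<in> carrier G \<Longrightarrow> h (x \<otimes>\<^bsub>G\<^esub> y) = h x + h y"
    by simp_all
qed

text \<open>Stated for general \<open>G\<close>, \<open>e\<close> and \<open>A\<close> so as to
  cover both free groups at once; \<open>A\<close> stands for the words of length at most 2.
  \<open>ext\<close> is the universal property for real-valued maps, and \<open>deg\<close> makes
  the copy of \<open>X\<close> closed in the subspace on \<open>A\<close>.\<close>

theorem compact_discrete_sum_if_locally_compact:
  fixes X :: "'a topology"
  assumes X: "Hausdorff_space X" "mu_space X"
    and F: "free_paratopological_group C X G e T"
    and ext: "\<And>f. continuous_map X euclideanreal f \<Longrightarrow>
                \<exists>h \<in> hom G real_group. continuous_map T euclideanreal h \<and> (\<forall>x \<in> topspace X. h (e x) = f x)"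
    and lc: "locally_compact_space (subtopology T A)"
    and eA: "\<And>x. x \<in> topspace X \<Longrightarrow> e x \<in> A"
    and diffA: "\<And>x y. x \<in> topspace X \<Longrightarrow> y \<in> topspace X \<Longrightarrow> e x \<otimes>\<^bsub>G\<^esub> inv\<^bsub>G\<^esub> e y \<in> A"
    and oneA: "\<one>\<^bsub>G\<^esub> \<in> A"
    and deg: "\<And>h a. h \<in> hom G real_group \<Longrightarrow> (\<And>x. x \<in> topspace X \<Longrightarrow> h (e x) = 1) \<Longrightarrow>
                a \<in> carrier G \<Longrightarrow> a \<in> A \<Longrightarrow> h a = 1 \<Longrightarrow> a \<in> e ` topspace X"
  shows "\<exists>(K :: 'a topology) (D :: 'a topology).
           compact_space K \<and> D = discrete_topology (topspace D) \<and>
           X homeomorphic_space sum_topology (\<lambda>b. if b then K else D) (UNIV :: bool set)"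
proof -
  have para: "paratopological_group G T" and emb: "embedding_map X T e"
    using F by (auto simp: free_paratopological_group_def)
  then have G: "group G" and top: "topspace T = carrier G"
    and mult: "continuous_map (prod_topology T T) T (\<lambda>(x, y). x \<otimes>\<^bsub>G\<^esub> y)"
    by (auto simp: paratopological_group_def)
  interpret group G by (rule G)
  note e_cont = continuous_map_from_embedding[OF emb]
  have e_in: "e x \<in> carrier G" if "x \<in> topspace X" for x
    using e_cont that top by (auto simp: continuous_map_def)
  have lcX: "locally_compact_space X"
  proof -
    \<comment> \<open>The degree homomorphism: inside \<open>A\<close> its fibre over 1 is exactly
      the copy of \<open>X\<close>.\<close>
    obtain h where h: "h \<in> hom G real_group" "continuous_map T euclideanreal h"
        "\<And>x. x \<in> topspace X \<Longrightarrow> h (e x) = 1"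
      using ext[of "\<lambda>_. 1"] by auto
    have "continuous_map (subtopology T A) euclideanreal h"
      using h(2) by (rule continuous_map_from_subtopology)
    then have "closedin (subtopology T A) {a \<in> topspace (subtopology T A). h a \<in> {1}}"
      by (rule closedin_continuous_map_preimage) auto
    moreover have "{a \<in> topspace (subtopology T A). h a \<in> {1}} = e ` topspace X"
      using deg[OF h(1)] h(3) eA e_in top by auto
    ultimately have "locally_compact_space (subtopology (subtopology T A) (e ` topspace X))"
      using locally_compact_space_closed_subset[OF lc] by simp
    moreover have "A \<inter> e ` topspace X = e ` topspace X"
      using eA by auto
    ultimately have "locally_compact_space (subtopology T (e ` topspace X))"
      by (simp add: subtopology_subtopology)
    then show ?thesis
      using homeomorphic_locally_compact_space[OF embedding_map_imp_homeomorphic_space[OF emb]] by simp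
  qed
  then have cr: "completely_regular_space X"
    using X(1) locally_compact_regular_imp_completely_regular_space by blast
  \<comment> \<open>A compact neighbourhood of the unit exists only in the subspace on
    \<open>A\<close>; lifting its open part to \<open>T\<close> gives \<open>W\<close>, of which the
    trace on \<open>A\<close> lies in \<open>K\<close>.\<close>
  obtain W K where W: "openin T W" "\<one>\<^bsub>G\<^esub> \<in> W" and K: "compactin T K" and WK: "W \<inter> A \<subseteq> K"
  proof -
    have "\<one>\<^bsub>G\<^esub> \<in> topspace (subtopology T A)"
      using oneA top by simp
    then obtain U K where U: "openin (subtopology T A) U" "\<one>\<^bsub>G\<^esub> \<in> U" "U \<subseteq> K"
        and K: "compactin (subtopology T A) K"
      using lc unfolding locally_compact_space_def by blast
    obtain W where W: "openin T W" "U = W \<inter> A"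
      using U(1) unfolding openin_subtopology by blast
    from K have "compactin T K"
      by (simp add: compactin_subtopology)
    with that[of W K] W U show thesis
      by blast
  qed
  let ?D = "X derived_set_of topspace X"
  \<comment> \<open>The preimage under \<open>e\<close> of the translate of \<open>W\<close> by
    \<open>e y\<close>. The inverse is that of a fixed element, so continuity of a right translation
    makes it open.\<close>
  define V where "V y = {x \<in> topspace X. e x \<otimes>\<^bsub>G\<^esub> inv\<^bsub>G\<^esub> e y \<in> W}" for y
  have DX: "?D \<subseteq> topspace X"
    by (rule derived_set_of_subset_topspace)
  have V_open: "openin X (V y)" if "y \<in> ?D" for y
  proof -
    have "inv\<^bsub>G\<^esub> e y \<in> topspace T"
      using that DX e_in top by auto
    then have "continuous_map X (prod_topology T T) (\<lambda>x. (e x, inv\<^bsub>G\<^esub> e y))"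
      using e_cont by (simp add: continuous_map_paired)
    from continuous_map_compose[OF this mult]
    have "continuous_map X T (\<lambda>x. e x \<otimes>\<^bsub>G\<^esub> inv\<^bsub>G\<^esub> e y)"
      by (simp add: o_def)
    then show ?thesis
      unfolding V_def using W(1) by (rule openin_continuous_map_preimage)
  qed
  have V_self: "y \<in> V y" if "y \<in> ?D" for y
    using that DX e_in W(2) by (auto simp: V_def)
  have "bounded (f ` ?D)" if f: "continuous_map X euclideanreal f" for f
  proof (rule ccontr)
    assume "\<not> bounded (f ` ?D)"
    then obtain x y :: "nat \<Rightarrow> 'a" and g where g: "continuous_map X euclideanreal g"
      and xy: "\<And>n. y n \<in> ?D" "\<And>n. x n \<in> V (y n)" "\<And>n. g (x n) - g (y n) = real n"
      using unbounded_oscillation_near_nonisolated[OF cr Hausdorff_imp_t1_space[OF X(1)] f _ V_open V_self]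
      by metis
    obtain h where h: "h \<in> hom G real_group" "continuous_map T euclideanreal h"
        "\<And>x. x \<in> topspace X \<Longrightarrow> h (e x) = g x"
      using ext[OF g] by blast
    \<comment> \<open>Compactness bounds \<open>h\<close> on \<open>K\<close>, but the quotients of
      \<open>e (x n)\<close> by \<open>e (y n)\<close> lie in \<open>K\<close> and \<open>h\<close>
      takes the value n on the n-th.\<close>
    have "compactin euclideanreal (h ` K)"
      using K h(2) by (rule image_compactin)
    then have "bounded (h ` K)"
      by (simp add: compact_imp_bounded)
    then obtain c where c: "\<And>k. k \<in> K \<Longrightarrow> \<bar>h k\<bar> \<le> c"
      by (auto simp: bounded_iff)
    obtain n where n: "c < real n"
      using reals_Archimedean2 by blast
    have X': "x n \<in> topspace X" "y n \<in> topspace X"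
      using xy(1,2)[of n] DX by (auto simp: V_def)
    then have "e (x n) \<otimes>\<^bsub>G\<^esub> inv\<^bsub>G\<^esub> e (y n) \<in> K"
      using xy(2)[of n] WK diffA by (auto simp: V_def)
    from c[OF this] have "\<bar>g (x n) - g (y n)\<bar> \<le> c"
      using X' e_in by (simp add: real_hom_simps[OF G h(1)] h(3))
    with xy(3)[of n] n show False
      by simp
  qed
  then have "bounded_in X ?D"
    using DX by (simp add: bounded_in_def)
  then have "compactin X (X closure_of ?D)"
    using X(2) by (simp add: mu_space_def)
  \<comment> \<open>In a Hausdorff space the derived set is closed, hence its own closure.\<close>
  then have "compactin X ?D"
    using closedin_derived_set_of[OF X(1)] by (simp add: closure_of_closedin)
  then show ?thesis
    by (rule homeomorphic_compact_discrete_sum[OF X(1) lcX])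
qed

section \<open>Words of length at most 2 and degree 1\<close>

lemma FP2_degree_one:
  assumes h: "h \<in> hom (free_group S) real_group" "\<And>x. x \<in> S \<Longrightarrow> h (letter x) = 1"
    and w: "w \<in> carrier (free_group S)" "length w \<le> 2" "h w = 1"
  shows "w \<in> letter ` S"
proof -
  note simps = real_hom_simps[OF group_free_group h(1)]
  have h1: "h [(x, b)] = (if b then 1 else - 1)" if "x \<in> S" for x b
    using simps(2)[of "letter x"] that h(2) by (cases b) (simp_all add: inv_letter, simp add: free_group_def)
  have h0: "h [] = 0"
    using simps(1) by (simp add: free_group_def)
  consider "w = []" | x b where "w = [(x, b)]" | x b y c where "w = [(x, b), (y, c)]"
    using w(2) by (cases w; cases "tl w"; cases "tl (tl w)") auto
  then show ?thesis
  proof cases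
    case 1
    then show ?thesis
      using w h0 by simp
  next
    case 2
    then show ?thesis
      using w h1[of x b] by (cases b) (auto simp: free_group_def)
  next
    case 3
    then have xy: "x \<in> S" "y \<in> S" "reduced w"
      using w(1) by (auto simp: free_group_def)
    then have "w = [(x, b)] \<otimes>\<^bsub>free_group S\<^esub> [(y, c)]"
      using 3 by (auto simp: free_group_def reduced_Cons_Cons)
    then have "h w = h [(x, b)] + h [(y, c)]"
      using xy simps(3)[of "[(x, b)]" "[(y, c)]"] by (simp add: free_group_def)
    \<comment> \<open>Two letters of degree 1 or -1 add up to -2, 0 or 2, never to 1.\<close>
    then show ?thesis
      using w(3) h1 xy by (cases b; cases c) auto
  qed
qed

text \<open>The auxiliary \<open>d\<close> sends every generator to the one generator of the free
  Abelian group on a point and reads off its coefficient. In this form the coefficient sum is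
  visibly additive, and it agrees with \<open>h\<close> on generators.\<close>

lemma hom_free_Abelian_group_degree:
  assumes h: "h \<in> hom (free_Abelian_group S) real_group" "\<And>x. x \<in> S \<Longrightarrow> h (frag_of x) = 1"
    and c: "Poly_Mapping.keys c \<subseteq> S"
  shows "h c = real_of_int (\<Sum>x\<in>Poly_Mapping.keys c. Poly_Mapping.lookup c x)"
proof -
  define d :: "('a \<Rightarrow>\<^sub>0 int) \<Rightarrow> int"
    where "d c = Poly_Mapping.lookup (frag_extend (\<lambda>_. frag_of ()) c) ()" for c
  note simps = real_hom_simps[OF group_free_Abelian_group h(1)]
  have "h c = real_of_int (d c)"
    using c
  proof (rule free_Abelian_group_induct)
    show "h 0 = real_of_int (d 0)"
      using simps(1) by (simp add: d_def)
    show "h (a - b) = real_of_int (d (a - b))"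
      if "Poly_Mapping.keys a \<subseteq> S" "Poly_Mapping.keys b \<subseteq> S"
        "h a = real_of_int (d a)" "h b = real_of_int (d b)" for a b
      using that simps(2)[of b] simps(3)[of a "- b"]
      by (simp add: d_def frag_extend_diff lookup_minus)
  qed (simp add: h d_def)
  also have "d c = (\<Sum>x\<in>Poly_Mapping.keys c. Poly_Mapping.lookup c x)"
    by (simp add: d_def frag_extend_def lookup_sum)
  finally show ?thesis .
qed

text \<open>Length and coefficient sum have the same parity, so length at most 2 and sum 1 leave
  only length 1: a single generator with coefficient 1.\<close>

lemma AP2_degree_one:
  assumes h: "h \<in> hom (free_Abelian_group S) real_group" "\<And>x. x \<in> S \<Longrightarrow> h (frag_of x) = 1"
    and c: "c \<in> carrier (free_Abelian_group S)" "frag_length c \<le> 2" "h c = 1"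
  shows "c \<in> frag_of ` S"
proof -
  let ?K = "Poly_Mapping.keys c" and ?l = "Poly_Mapping.lookup c"
  have keys: "?K \<subseteq> S"
    using c(1) by simp
  have one: "(\<Sum>x\<in>?K. ?l x) = 1"
    using hom_free_Abelian_group_degree[OF h keys] c(3) by linarith
  \<comment> \<open>Each summand is 0 or -2 times the coefficient.\<close>
  have "even (\<Sum>x\<in>?K. \<bar>?l x\<bar> - ?l x)"
    by (rule dvd_sum) (auto simp: abs_if)
  moreover have "(\<Sum>x\<in>?K. \<bar>?l x\<bar> - ?l x) = frag_length c - 1"
    by (simp add: sum_subtractf one frag_length_def)
  moreover have "1 \<le> frag_length c"
    unfolding frag_length_def using one sum_mono[of ?K ?l "\<lambda>x. \<bar>?l x\<bar>"] by simp
  ultimately have len: "frag_length c = 1"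
    using c(2) by presburger
  have "int (card ?K) = (\<Sum>x\<in>?K. 1)"
    by simp
  also have "\<dots> \<le> frag_length c"
    unfolding frag_length_def
  proof (rule sum_mono)
    fix x assume "x \<in> ?K"
    then have "?l x \<noteq> 0" by (simp add: in_keys_iff)
    then show "1 \<le> \<bar>?l x\<bar>" by linarith
  qed
  finally have "card ?K \<le> 1"
    using len by simp
  moreover have "?K \<noteq> {}"
    using one by auto
  ultimately have "card ?K = 1"
    using card_0_eq[OF finite_keys, of c] by linarith
  then obtain x where x: "?K = {x}"
    by (rule card_1_singletonE)
  with one have "?l x = 1" by simp
  then have "c = frag_of x"
    using x by (intro poly_mapping_eqI) (auto simp: lookup_single when_def not_in_keys_iff_lookup_eq_zero[symmetric])
  then show ?thesis
    using x keys by blast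
qed

section \<open>The free Abelian and the free paratopological group as instances\<close>

theorem theorem4p17:
  fixes X :: "'a topology"
  assumes "Hausdorff_space X"
    and "mu_space X"
    and "locally_compact_space (AP2 X) \<or> locally_compact_space (FP2 X)"
  shows "\<exists>(K :: 'a topology) (D :: 'a topology).
           compact_space K \<and> D = discrete_topology (topspace D) \<and>
           X homeomorphic_space sum_topology (\<lambda>b. if b then K else D) (UNIV :: bool set)"
  using assms(3)
proof
  assume lc: "locally_compact_space (AP2 X)"
  show ?thesis
  proof (rule compact_discrete_sum_if_locally_compact[OF assms(1,2) AP_free _ lc[unfolded AP2_def]])
    fix f assume "continuous_map X euclideanreal f"
    then show "\<exists>h\<in>hom (free_Abelian_group (topspace X)) real_group.
        continuous_map (AP X) euclideanreal h \<and> (\<forall>x\<in>topspace X. h (frag_of x) = f x)"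
      using AP_universal[OF comm_group_real_group paratopological_group_real_group] by metis
  next
    fix x y assume xy: "x \<in> topspace X" "y \<in> topspace X"
    have "frag_length (frag_of x - frag_of y) \<le> 2"
    proof (cases "x = y")
      case True
      then show ?thesis by (simp add: frag_length_def)
    next
      case False
      have "Poly_Mapping.keys (frag_of x - frag_of y) \<subseteq> {x, y}"
        using keys_diff[of "frag_of x" "frag_of y"] by auto
      \<comment> \<open>Summing over \<open>{x, y}\<close> avoids determining the exact set of keys,
        since other entries are 0.\<close>
      then have "frag_length (frag_of x - frag_of y)
                   = (\<Sum>z\<in>{x, y}. \<bar>Poly_Mapping.lookup (frag_of x - frag_of y) z\<bar>)"
        unfolding frag_length_def by (intro sum.mono_neutral_left) (auto simp: in_keys_iff)
      also have "\<dots> = 2"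
        using False by (simp add: lookup_minus lookup_single)
      finally show ?thesis by simp
    qed
    then show "frag_of x \<otimes>\<^bsub>free_Abelian_group (topspace X)\<^esub>
                 inv\<^bsub>free_Abelian_group (topspace X)\<^esub> frag_of y \<in> {c. frag_length c \<le> 2}"
      using xy by simp
  next
    fix h a
    assume "h \<in> hom (free_Abelian_group (topspace X)) real_group"
      "\<And>x. x \<in> topspace X \<Longrightarrow> h (frag_of x) = 1"
      "a \<in> carrier (free_Abelian_group (topspace X))" "a \<in> {c. frag_length c \<le> 2}" "h a = 1"
    then show "a \<in> frag_of ` topspace X"
      using AP2_degree_one[of h "topspace X" a] by simp
  qed (auto simp: frag_length_def)
next
  assume lc: "locally_compact_space (FP2 X)"
  show ?thesis
  proof (rule compact_discrete_sum_if_locally_compact[OF assms(1,2) FP_free _ lc[unfolded FP2_def]])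
    fix f assume "continuous_map X euclideanreal f"
    then show "\<exists>h\<in>hom (free_group (topspace X)) real_group.
        continuous_map (FP X) euclideanreal h \<and> (\<forall>x\<in>topspace X. h (letter x) = f x)"
      using FP_universal[OF paratopological_group_real_group] by metis
  next
    fix x y assume xy: "x \<in> topspace X" "y \<in> topspace X"
    then show "letter x \<otimes>\<^bsub>free_group (topspace X)\<^esub> inv\<^bsub>free_group (topspace X)\<^esub> letter y
                 \<in> {w. length w \<le> 2}"
      by (simp add: inv_letter) (simp add: free_group_def)
  next
    fix h a
    assume "h \<in> hom (free_group (topspace X)) real_group"
      "\<And>x. x \<in> topspace X \<Longrightarrow> h (letter x) = 1"
      "a \<in> carrier (free_group (topspace X))" "a \<in> {w. length w \<le> 2}" "h a = 1"
    then show "a \<in> letter ` topspace X"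
      using FP2_degree_one[of h "topspace X" a] by simp
  qed (auto simp: free_group_def)
qed

end
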